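(* Let $U$ be a positive random variable with $\mathbb{E}[U]=1$. Then $$\mathbb{E}[U\log U]\ \ge\ \frac{\big(\mathbb{E}[(U-1)^2]\big)^2}{2\,\mathbb{E}[(U-1)^2]+\frac23\,\mathbb{E}[(U-1)^3]}.$$
   Context: $\log$ is the natural logarithm. *)

theory Defs
  imports "HOL-Probability.Probability"
begin

text \<open>
  Expectation with values in the extended reals.  The Bochner integral returns 0 for
  non-integrable functions, so it cannot be used for moments that may be infinite.  The
  definition is meaningful when at least one of the two parts is finite; this holds for every
  function that is bounded below on a probability space, in particular for \<open>U ln U\<close>,
  \<open>(U - 1)\<^sup>2\<close> and \<open>(U - 1)\<^sup>3\<close> with \<open>U > 0\<close>.

  Division of extended reals is \<open>a / b = a * inverse b\<close> with \<open>inverse \<infinity> = 0\<close>,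
  \<open>inverse 0 = \<infinity>\<close> and \<open>0 * \<infinity> = 0\<close>; hence \<open>a / \<infinity> = 0\<close> (also for \<open>a = \<infinity>\<close>) and \<open>0 / 0 = 0\<close>.
\<close>

definition ext_expectation :: "'a measure \<Rightarrow> ('a \<Rightarrow> real) \<Rightarrow> ereal" where
  "ext_expectation M X =
     enn2ereal (\<integral>\<^sup>+ x. ennreal (X x) \<partial>M) - enn2ereal (\<integral>\<^sup>+ x. ennreal (- X x) \<partial>M)"

lemma ext_expectation_eq_integral:
  assumes "integrable M X"
  shows "ext_expectation M X = ereal (integral\<^sup>L M X)"
proof -
  have *: "enn2ereal a = ereal (enn2real a)" if "a < top" for a
    using that by (cases a) auto
  have "(\<integral>\<^sup>+ x. ennreal (X x) \<partial>M) < top" "(\<integral>\<^sup>+ x. ennreal (- X x) \<partial>M) < top"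
    using assms by (auto simp: real_integrable_def less_top)
  then show ?thesis
    by (simp add: ext_expectation_def real_lebesgue_integral_def[OF assms] *)
qed

lemma ext_expectation_eq_infinity:
  assumes "X \<in> borel_measurable M" "\<not> integrable M X"
    and "(\<integral>\<^sup>+ x. ennreal (- X x) \<partial>M) < top"
  shows "ext_expectation M X = \<infinity>"
proof -
  have "(\<integral>\<^sup>+ x. ennreal (X x) \<partial>M) = top"
    using assms by (auto simp: real_integrable_def)
  moreover have "enn2ereal (\<integral>\<^sup>+ x. ennreal (- X x) \<partial>M) \<noteq> \<infinity>"
    using assms(3) by (cases "\<integral>\<^sup>+ x. ennreal (- X x) \<partial>M") auto
  ultimately show ?thesis
    by (simp add: ext_expectation_def)
qed

end

theory Submission
  imports Defs
begin

text \<open>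
  Put \<open>V = U - 1 > -1\<close>. Pointwise \<open>U ln U - V \<ge> V\<^sup>2 / (2 + 2 V / 3)\<close>, and the claim follows from
  Cauchy--Schwarz for \<open>V / sqrt (2 + 2 V / 3)\<close> and \<open>V * sqrt (2 + 2 V / 3)\<close>. Cauchy--Schwarz is used
  in its linearised form: \<open>V\<^sup>2 / W \<ge> 2 t V\<^sup>2 - t\<^sup>2 V\<^sup>2 W\<close> for every \<open>t\<close>, integrated and evaluated at
  the optimal \<open>t = E[V\<^sup>2] / E[V\<^sup>2 W]\<close>. If the third moment is infinite, the right-hand side is 0.
\<close>

text \<open>The difference \<open>f\<close> of the two sides vanishes at 1, and its derivative
  \<open>(x - 1) ^ 3 / (x\<^sup>2 * (x + 2)\<^sup>2)\<close> has the sign of \<open>x - 1\<close>,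
  so 1 is a global minimum on the positive axis. The rational function is the lower bound of
  \<open>mult_ln_ge\<close> divided by \<open>u\<close>.\<close>

lemma ln_ge_rational:
  fixes u :: real
  assumes "u > 0"
  shows "ln u \<ge> (u - 1) * (5 * u + 1) / (2 * u * (u + 2))"
proof -
  define f where "f = (\<lambda>u::real. ln u - (u - 1) * (5 * u + 1) / (2 * u * (u + 2)))"
  have deriv: "(f has_real_derivative (x - 1) ^ 3 / (x\<^sup>2 * (x + 2)\<^sup>2)) (at x)" if "x > 0" for x
    unfolding f_def using that
    apply (auto intro!: derivative_eq_intros)
    apply (simp add: divide_simps)
    apply (simp add: algebra_simps power2_eq_square power3_eq_cube power4_eq_xxxx)
    done
  have "f u \<ge> f 1"
  proof (cases "u \<ge> 1")
    case True
    then show ?thesis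
      by (intro DERIV_nonneg_imp_nondecreasing[of 1 u f])
        (auto intro!: exI[of _ "(_ - 1) ^ 3 / _"] deriv)
  next
    case False
    show ?thesis
    proof (rule DERIV_nonpos_imp_nonincreasing[of u 1 f])
      fix x assume "u \<le> x" "x \<le> 1"
      then show "\<exists>y. DERIV f x :> y \<and> y \<le> 0"
        using deriv[of x] assms
        by (intro exI[of _ "(x - 1) ^ 3 / (x\<^sup>2 * (x + 2)\<^sup>2)"])
          (auto intro!: divide_nonpos_nonneg simp: power3_eq_cube mult_nonneg_nonpos)
    qed (use False in auto)
  qed
  then show ?thesis
    by (simp add: f_def)
qed

text \<open>The denominator equals \<open>2 * (u + 2) / 3\<close>, hence is positive. Its
  coefficient \<open>2 / 3\<close> makes the two sides agree at \<open>u = 1\<close> up to third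
  order.\<close>

lemma mult_ln_ge:
  fixes u :: real
  assumes "u > 0"
  shows "u * ln u \<ge> u - 1 + (u - 1)\<^sup>2 / (2 + 2 / 3 * (u - 1))"
proof -
  have "u - 1 + (u - 1)\<^sup>2 / (2 + 2 / 3 * (u - 1))
      = u * ((u - 1) * (5 * u + 1) / (2 * u * (u + 2)))"
    using assms by (simp add: divide_simps) (simp add: algebra_simps power2_eq_square)
  also have "\<dots> \<le> u * ln u"
    using assms ln_ge_rational by (intro mult_left_mono) auto
  finally show ?thesis .
qed

lemma mult_ln_ge_diff:
  fixes u :: real
  assumes "u > 0"
  shows "u * ln u \<ge> u - 1"
proof -
  have "(u - 1)\<^sup>2 / (2 + 2 / 3 * (u - 1)) \<ge> 0"
    using assms by (intro divide_nonneg_nonneg) (auto simp: field_simps)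
  then show ?thesis
    using mult_ln_ge[OF assms] by linarith
qed

text \<open>The gap between the two sides is a square over \<open>w\<close>, zero for
  \<open>t = 1 / w\<close>. With \<open>t\<close> constant, the lower bound is linear in
  \<open>a\<^sup>2\<close> and \<open>a\<^sup>2 * w\<close>, so its integral involves only
  moments.\<close>

lemma square_div_ge:
  fixes a w t :: real
  assumes "w > 0"
  shows "a\<^sup>2 / w \<ge> 2 * t * a\<^sup>2 - t\<^sup>2 * (a\<^sup>2 * w)"
proof -
  have "a\<^sup>2 / w - (2 * t * a\<^sup>2 - t\<^sup>2 * (a\<^sup>2 * w)) = a\<^sup>2 * (1 - t * w)\<^sup>2 / w"
    using assms by (simp add: field_simps power2_eq_square)
  also have "\<dots> \<ge> 0"
    using assms by simp
  finally show ?thesis by simp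
qed

context prob_space
begin

text \<open>Since the total mass is 1, a lower bound keeps the integral of the negative part finite;
  integrability can then fail only through the positive part.\<close>

lemma ext_expectation_eq_infinity_of_bounded_below:
  assumes "X \<in> borel_measurable M" "\<not> integrable M X" "AE x in M. X x \<ge> - c"
  shows "ext_expectation M X = \<infinity>"
proof (rule ext_expectation_eq_infinity[OF assms(1,2)])
  have "(\<integral>\<^sup>+ x. ennreal (- X x) \<partial>M) \<le> (\<integral>\<^sup>+ x. ennreal c \<partial>M)"
    using assms(3) by (intro nn_integral_mono_AE) (auto intro!: ennreal_leI)
  also have "\<dots> < top"
    by (simp add: emeasure_space_1)
  finally show "(\<integral>\<^sup>+ x. ennreal (- X x) \<partial>M) < top" .
qed

text \<open>The minorant \<open>U - 1\<close> of \<open>U * ln U\<close> has mean 0. This settles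
  the case of an infinite third moment.\<close>

lemma ext_expectation_mult_ln_nonneg:
  fixes U :: "'a \<Rightarrow> real"
  assumes [measurable]: "U \<in> borel_measurable M"
    and pos: "AE x in M. U x > 0"
    and int: "integrable M U"
    and mean: "expectation U = 1"
  shows "ext_expectation M (\<lambda>x. U x * ln (U x)) \<ge> 0"
proof (cases "integrable M (\<lambda>x. U x * ln (U x))")
  case True
  have "(\<integral>x. U x - 1 \<partial>M) \<le> (\<integral>x. U x * ln (U x) \<partial>M)"
    using pos by (intro integral_mono_AE True) (auto simp: int mult_ln_ge_diff)
  then show ?thesis
    by (simp add: ext_expectation_eq_integral[OF True] int mean prob_space)
next
  case False
  have "AE x in M. U x * ln (U x) \<ge> - 1"
    using pos
  proof eventually_elim
    case (elim x)
    then show ?case using mult_ln_ge_diff[of "U x"] by linarith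
  qed
  with False show ?thesis
    by (subst ext_expectation_eq_infinity_of_bounded_below[where c = 1]) auto
qed

lemma ext_expectation_square_nonneg: "ext_expectation M (\<lambda>x. (X x)\<^sup>2) \<ge> 0"
  by (simp add: ext_expectation_def ennreal_neg zero_ennreal.rep_eq)

lemma integrable_square_of_cube:
  fixes X :: "'a \<Rightarrow> real"
  assumes [measurable]: "X \<in> borel_measurable M" and "integrable M (\<lambda>x. X x ^ 3)"
  shows "integrable M (\<lambda>x. (X x)\<^sup>2)"
proof (rule Bochner_Integration.integrable_bound)
  show "integrable M (\<lambda>x. 1 + \<bar>X x ^ 3\<bar>)"
    using assms by auto
  have "y\<^sup>2 \<le> 1 + \<bar>y ^ 3\<bar>" for y :: real
  proof (cases "\<bar>y\<bar> \<le> 1")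
    case True
    then have "y\<^sup>2 \<le> 1" by (simp add: abs_square_le_1)
    then show ?thesis by (smt (verit))
  next
    case False
    then have "\<bar>y\<bar> ^ 2 \<le> \<bar>y\<bar> ^ 3" by (intro power_increasing) auto
    then show ?thesis by (simp add: power_abs)
  qed
  then show "AE x in M. norm ((X x)\<^sup>2) \<le> norm (1 + \<bar>X x ^ 3\<bar>)"
    by simp
qed simp

text \<open>\<open>u * ln u\<close> lies between \<open>u - 1\<close> and
  \<open>u * (u - 1) = (u - 1) + (u - 1)\<^sup>2\<close>, the upper bound coming from
  \<open>ln u \<le> u - 1\<close>.\<close>

lemma integrable_mult_ln:
  fixes U :: "'a \<Rightarrow> real"
  assumes [measurable]: "U \<in> borel_measurable M"
    and pos: "AE x in M. U x > 0"
    and int: "integrable M U"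
    and int2: "integrable M (\<lambda>x. (U x - 1)\<^sup>2)"
  shows "integrable M (\<lambda>x. U x * ln (U x))"
proof (rule Bochner_Integration.integrable_bound)
  show "integrable M (\<lambda>x. \<bar>U x - 1\<bar> + (U x - 1)\<^sup>2)"
    using int int2 by auto
  show "AE x in M. norm (U x * ln (U x)) \<le> norm (\<bar>U x - 1\<bar> + (U x - 1)\<^sup>2)"
    using pos
  proof eventually_elim
    case (elim x)
    have "U x * ln (U x) \<le> U x * (U x - 1)"
      using elim ln_le_minus_one by (intro mult_left_mono) auto
    also have "\<dots> = (U x - 1) + (U x - 1)\<^sup>2"
      by (simp add: algebra_simps power2_eq_square)
    finally have "\<bar>U x * ln (U x)\<bar> \<le> \<bar>U x - 1\<bar> + (U x - 1)\<^sup>2"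
      using mult_ln_ge_diff[OF elim] zero_le_power2[of "U x - 1"] by linarith
    then show ?case by simp
  qed
qed simp

lemma expectation_mult_ln_ge:
  fixes U :: "'a \<Rightarrow> real"
  assumes [measurable]: "U \<in> borel_measurable M"
    and pos: "AE x in M. U x > 0"
    and int: "integrable M U"
    and mean: "expectation U = 1"
    and int3: "integrable M (\<lambda>x. (U x - 1) ^ 3)"
  defines "A \<equiv> expectation (\<lambda>x. (U x - 1)\<^sup>2)"
    and "B \<equiv> expectation (\<lambda>x. (U x - 1) ^ 3)"
  shows "expectation (\<lambda>x. U x * ln (U x)) \<ge> A\<^sup>2 / (2 * A + 2 / 3 * B)"
proof -
  have int2: "integrable M (\<lambda>x. (U x - 1)\<^sup>2)"
    by (rule integrable_square_of_cube[where X = "\<lambda>x. U x - 1"]) (use int3 in auto)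
  define t where "t = A / (2 * A + 2 / 3 * B)"
  let ?g = "\<lambda>x. (U x - 1) + 2 * t * (U x - 1)\<^sup>2
              - t\<^sup>2 * (2 * (U x - 1)\<^sup>2 + 2 / 3 * (U x - 1) ^ 3)"
  have "A\<^sup>2 / (2 * A + 2 / 3 * B) = 2 * t * A - t\<^sup>2 * (2 * A + 2 / 3 * B)"
    \<comment> \<open>If the denominator is 0, real division by zero gives \<open>t = 0\<close>, and
      both sides are 0.\<close>
    unfolding t_def by (cases "2 * A + 2 / 3 * B = 0") (simp_all add: power2_eq_square)
  also have "\<dots> = expectation ?g"
    using int int2 int3 by (simp add: A_def B_def mean prob_space)
  also have "\<dots> \<le> expectation (\<lambda>x. U x * ln (U x))"
  proof (rule integral_mono_AE)
    show "integrable M ?g"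
      using int int2 int3 by auto
    show "integrable M (\<lambda>x. U x * ln (U x))"
      by (rule integrable_mult_ln) (use pos int int2 in auto)
    show "AE x in M. ?g x \<le> U x * ln (U x)"
      using pos
    proof eventually_elim
      case (elim x)
      have "2 + 2 / 3 * (U x - 1) > 0"
        using elim by (simp add: field_simps)
      from square_div_ge[OF this, where a = "U x - 1" and t = t] mult_ln_ge[OF elim]
      have "U x - 1 + (2 * t * (U x - 1)\<^sup>2
          - t\<^sup>2 * ((U x - 1)\<^sup>2 * (2 + 2 / 3 * (U x - 1)))) \<le> U x * ln (U x)"
        by linarith
      moreover have "(U x - 1)\<^sup>2 * (2 + 2 / 3 * (U x - 1))
          = 2 * (U x - 1)\<^sup>2 + 2 / 3 * (U x - 1) ^ 3"
        by (simp add: power2_eq_square power3_eq_cube distrib_left)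
      ultimately show ?case by simp
    qed
  qed
  finally show ?thesis .
qed

end

theorem lemma4:
  fixes M :: "'a measure" and U :: "'a \<Rightarrow> real"
  assumes "prob_space M"
    and "U \<in> borel_measurable M"
    and "AE x in M. U x > 0"
    and "integrable M U"
    and "prob_space.expectation M U = 1"
  shows "ext_expectation M (\<lambda>x. U x * ln (U x)) \<ge>
    (ext_expectation M (\<lambda>x. (U x - 1) ^ 2)) ^ 2 /
      (2 * ext_expectation M (\<lambda>x. (U x - 1) ^ 2)
        + ereal (2 / 3) * ext_expectation M (\<lambda>x. (U x - 1) ^ 3))"
proof -
  interpret prob_space M by fact
  note [measurable] = assms(2)
  let ?A = "ext_expectation M (\<lambda>x. (U x - 1)\<^sup>2)"
  show ?thesis
  proof (cases "integrable M (\<lambda>x. (U x - 1) ^ 3)")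
    case int3: True
    define A B where "A = expectation (\<lambda>x. (U x - 1)\<^sup>2)"
      and "B = expectation (\<lambda>x. (U x - 1) ^ 3)"
    have int2: "integrable M (\<lambda>x. (U x - 1)\<^sup>2)"
      by (rule integrable_square_of_cube[where X = "\<lambda>x. U x - 1"]) (use int3 in auto)
    have EA: "?A = ereal A"
      and EB: "ext_expectation M (\<lambda>x. (U x - 1) ^ 3) = ereal B"
      and EL: "ext_expectation M (\<lambda>x. U x * ln (U x))
        = ereal (expectation (\<lambda>x. U x * ln (U x)))"
      by (auto simp: A_def B_def
          intro!: ext_expectation_eq_integral integrable_mult_ln int2 int3 assms)
    have "A \<ge> 0"
      by (simp add: A_def)
    \<comment> \<open>Since \<open>U - 1 > -1\<close>, the cube is at least
      \<open>- (U - 1)\<^sup>2\<close>, so \<open>B \<ge> - A\<close>. Thus the denominator can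
      vanish only if \<open>A = 0\<close>.\<close>
    have "4 / 3 * A \<le> 2 * A + 2 / 3 * B"
    proof -
      have "expectation (\<lambda>x. - (U x - 1)\<^sup>2) \<le> B"
        unfolding B_def
      proof (rule integral_mono_AE)
        show "AE x in M. - (U x - 1)\<^sup>2 \<le> (U x - 1) ^ 3"
          using assms(3)
        proof eventually_elim
          case (elim x)
          have "(U x - 1) ^ 3 - - (U x - 1)\<^sup>2 = U x * (U x - 1)\<^sup>2"
            by (simp add: power2_eq_square power3_eq_cube algebra_simps)
          also have "\<dots> \<ge> 0"
            using elim by simp
          finally show ?case by simp
        qed
      qed (use int2 int3 in auto)
      then show ?thesis
        by (simp add: A_def)
    qed
    then have "A = 0 \<or> 2 * A + 2 / 3 * B \<noteq> 0"
      using \<open>A \<ge> 0\<close> by linarith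
    \<comment> \<open>Real and extended division differ when a positive number is divided by 0; that
      is excluded here, and \<open>0 / 0\<close> is 0 in both.\<close>
    then have "(ereal A)\<^sup>2 / ereal (2 * A + 2 / 3 * B) = ereal (A\<^sup>2 / (2 * A + 2 / 3 * B))"
      by (auto simp: power2_eq_square ereal_divide simp flip: zero_ereal_def)
    moreover have "2 * ereal A + ereal (2 / 3) * ereal B = ereal (2 * A + 2 / 3 * B)"
      by simp
    ultimately show ?thesis
      using expectation_mult_ln_ge[OF assms(2-5) int3]
      unfolding EA EB EL by (simp only: ereal_less_eq A_def B_def)
  next
    case False
    have "AE x in M. (U x - 1) ^ 3 \<ge> - 1"
      using assms(3)
    proof eventually_elim
      case (elim x)
      then show ?case using power_mono_odd[of 3 "-1" "U x - 1"] by simp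
    qed
    with False have "ext_expectation M (\<lambda>x. (U x - 1) ^ 3) = \<infinity>"
      by (intro ext_expectation_eq_infinity_of_bounded_below) auto
    moreover have "2 * ?A \<ge> 0"
      using ext_expectation_square_nonneg[of "\<lambda>x. U x - 1"] by (simp add: ereal_zero_le_0_iff)
    ultimately have "2 * ?A + ereal (2 / 3) * ext_expectation M (\<lambda>x. (U x - 1) ^ 3) = \<infinity>"
      by auto
    \<comment> \<open>An infinite denominator makes the quotient 0 even if \<open>?A\<close> is
      infinite, so nonnegativity of the left-hand side suffices.\<close>
    then show ?thesis
      using ext_expectation_mult_ln_nonneg[OF assms(2-5)]
      by (simp only: ereal_divide_Infty)
  qed
qed

end
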